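(* Let $n$ be a positive integer. Consider the following procedure. 1. Generate all ordered $n$-tuples of natural numbers $\langle k_1,\ldots,k_n\rangle$ with $1\le k_i\le 2^n-2$ for $i=1,\dots,n$ and $k_1\le k_i$ for $i=2,\ldots,n$. 2. Keep those tuples whose corresponding matrix belongs to $\mathcal{Q}_n$ (checked by testing that no column consists only of zeroes and no column consists only of ones). 3. Among the matrices $A$ kept in step 2, keep those with $A\le P^k*A*P^l$ in the lexicographic order for all $k,l\in\{0,1,\ldots,n-1\}$. 4. Among the matrices kept in step 3, select those with $A\sim A^S$. 5. Among the matrices kept in step 3, select those with $A\sim A^R$. Then the matrices kept in step 3 contain exactly one representative of each equivalence class in $\overline{\mathcal{Q}_n}$, those selected in step 4 contain exactly one representative of each equivalence class in $\overline{\mathcal{M}_n}$, those selected in step 5 contain exactly one representative of each equivalence class in $\overline{\mathcal{R}_n}$, and neither of these three lists contains any other matrix; in each case the representative is the minimal element of its equivalence class with respect to the lexicographic order.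
   Context: $\mathcal{B}_n$ is the set of all $n\times n$ matrices with entries in $\{0,1\}$; $\mathcal{Q}_n\subset\mathcal{B}_n$ is the set of those having at least one $0$ and at least one $1$ in every row and in every column. A matrix $A=(a_{ij})\in\mathcal{B}_n$ is represented by (and identified with) the tuple $\langle k_1,\dots,k_n\rangle$ with $k_i=\sum_{j=1}^n a_{ij}2^{n-j}$, so $0\le k_i\le 2^n-1$; the lexicographic order on $\mathcal{B}_n$ is the lexicographic order on these tuples. $A\sim B$ means that one matrix is obtained from the other by a finite (possibly empty) sequence of moves, each move taking the first row to the last place or the first column to the last place (the other rows, respectively columns, being shifted cyclically). This is an equivalence relation on $\mathcal{B}_n$. $\overline{\mathcal{Q}_n}$ is the set of equivalence classes of elements of $\mathcal{Q}_n$. For $A=(a_{ij})$, $A^S=(a_{i,\,n-j+1})$ (columns in reverse order), and $A^R=(A^S)^T$ ($A$ rotated by $90^\circ$ counterclockwise). $\overline{\mathcal{M}_n}\subset\overline{\mathcal{Q}_n}$ is the set of classes of matrices $A\in\mathcal{Q}_n$ with $A\sim A^S$, and $\overline{\mathcal{R}_n}\subset\overline{\mathcal{Q}_n}$ is the set of classes of matrices $A\in\mathcal{Q}_n$ with $A\sim A^R$ (these properties do not depend on the representative of the class). $P=(p_{ij})$ is the $n\times n$ permutation matrix with $p_{i,i+1}=1$ for $1\le i\le n-1$, $p_{n,1}=1$, and all other entries $0$; $P^k$ is its $k$-th power, $P^0$ being the identity matrix. The logical product is $A*B=(c_{ij})$ with $c_{ij}=\bigvee_{k=1}^{n}(a_{ik}\wedge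 b_{kj})$. *)

theory Defs
  imports "Jordan_Normal_Form.Matrix" "HOL-Library.List_Lexorder"
begin

text \<open>Binary matrices are matrices over \<^typ>\<open>nat\<close> with entries in {0,1}. Matrix indices start at 0,
  so the position (i, j) of the 1-based mathematical notation is (i - 1, j - 1) here.\<close>

definition binary_mats :: "nat \<Rightarrow> nat mat set" where
  "binary_mats n = {A \<in> carrier_mat n n. \<forall>i<n. \<forall>j<n. A $$ (i, j) \<in> {0, 1}}"

definition Q_mats :: "nat \<Rightarrow> nat mat set" where
  "Q_mats n = {A \<in> binary_mats n.
     (\<forall>i<n. (\<exists>j<n. A $$ (i, j) = 0) \<and> (\<exists>j<n. A $$ (i, j) = 1)) \<and>
     (\<forall>j<n. (\<exists>i<n. A $$ (i, j) = 0) \<and> (\<exists>i<n. A $$ (i, j) = 1))}"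

text \<open>The tuple of row codes; the exponent \<open>n - j\<close> of the 1-based formula becomes
  \<open>n - 1 - j\<close>.\<close>

definition row_tuple :: "nat mat \<Rightarrow> nat list" where
  "row_tuple A =
     map (\<lambda>i. \<Sum>j<dim_col A. A $$ (i, j) * 2 ^ (dim_col A - 1 - j)) [0..<dim_row A]"

definition lex_le :: "nat mat \<Rightarrow> nat mat \<Rightarrow> bool" where
  "lex_le A B \<longleftrightarrow> row_tuple A \<le> row_tuple B"

definition first_row_last :: "nat mat \<Rightarrow> nat mat" where
  "first_row_last A =
     mat (dim_row A) (dim_col A) (\<lambda>(i, j). A $$ (Suc i mod dim_row A, j))"

definition first_col_last :: "nat mat \<Rightarrow> nat mat" where
  "first_col_last A =
     mat (dim_row A) (dim_col A) (\<lambda>(i, j). A $$ (i, Suc j mod dim_col A))"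

definition cyc_move :: "nat mat \<Rightarrow> nat mat \<Rightarrow> bool" where
  "cyc_move A B \<longleftrightarrow> B = first_row_last A \<or> B = first_col_last A"

definition cyc_equiv :: "nat mat \<Rightarrow> nat mat \<Rightarrow> bool" where
  "cyc_equiv A B \<longleftrightarrow> cyc_move\<^sup>*\<^sup>* A B \<or> cyc_move\<^sup>*\<^sup>* B A"

definition cyc_rel :: "nat \<Rightarrow> (nat mat \<times> nat mat) set" where
  "cyc_rel n = {(A, B). A \<in> binary_mats n \<and> B \<in> binary_mats n \<and> cyc_equiv A B}"

definition col_reverse :: "nat mat \<Rightarrow> nat mat" where
  "col_reverse A = mat (dim_row A) (dim_col A) (\<lambda>(i, j). A $$ (i, dim_col A - 1 - j))"

definition rotate_ccw :: "nat mat \<Rightarrow> nat mat" where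
  "rotate_ccw A = transpose_mat (col_reverse A)"

definition Q_classes :: "nat \<Rightarrow> nat mat set set" where
  "Q_classes n = Q_mats n // cyc_rel n"

definition M_classes :: "nat \<Rightarrow> nat mat set set" where
  "M_classes n = {A \<in> Q_mats n. cyc_equiv A (col_reverse A)} // cyc_rel n"

definition R_classes :: "nat \<Rightarrow> nat mat set set" where
  "R_classes n = {A \<in> Q_mats n. cyc_equiv A (rotate_ccw A)} // cyc_rel n"

definition cyc_perm_mat :: "nat \<Rightarrow> nat mat" where
  "cyc_perm_mat n =
     mat n n (\<lambda>(i, j). if j = i + 1 \<or> (i = n - 1 \<and> j = 0) then 1 else 0)"

definition logical_prod :: "nat mat \<Rightarrow> nat mat \<Rightarrow> nat mat" (infixl \<open>*\<^sub>L\<close> 70) where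
  "A *\<^sub>L B = mat (dim_row A) (dim_col B)
     (\<lambda>(i, j). if \<exists>k<dim_col A. A $$ (i, k) = 1 \<and> B $$ (k, j) = 1 then 1 else 0)"

definition step1 :: "nat \<Rightarrow> nat list set" where
  "step1 n = {ks. length ks = n \<and> (\<forall>i<n. 1 \<le> ks ! i \<and> ks ! i \<le> 2 ^ n - 2) \<and>
     (\<forall>i. 1 \<le> i \<and> i < n \<longrightarrow> ks ! 0 \<le> ks ! i)}"

text \<open>From here on a tuple is identified with the binary matrix it represents.\<close>

definition step2 :: "nat \<Rightarrow> nat mat set" where
  "step2 n = {A \<in> binary_mats n. row_tuple A \<in> step1 n \<and> A \<in> Q_mats n}"

definition no_constant_col :: "nat mat \<Rightarrow> bool" where
  "no_constant_col A \<longleftrightarrow> (\<forall>j<dim_col A.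
     \<not> (\<forall>i<dim_row A. A $$ (i, j) = 0) \<and> \<not> (\<forall>i<dim_row A. A $$ (i, j) = 1))"

definition step3 :: "nat \<Rightarrow> nat mat set" where
  "step3 n = {A \<in> step2 n. \<forall>k<n. \<forall>l<n.
     lex_le A (cyc_perm_mat n ^\<^sub>m k *\<^sub>L A *\<^sub>L cyc_perm_mat n ^\<^sub>m l)}"

definition step4 :: "nat \<Rightarrow> nat mat set" where
  "step4 n = {A \<in> step3 n. cyc_equiv A (col_reverse A)}"

definition step5 :: "nat \<Rightarrow> nat mat set" where
  "step5 n = {A \<in> step3 n. cyc_equiv A (rotate_ccw A)}"

definition lists_minimal_representatives :: "nat mat set \<Rightarrow> nat mat set set \<Rightarrow> bool" where
  "lists_minimal_representatives L \<C> \<longleftrightarrow>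
     (\<forall>C\<in>\<C>. \<exists>!A. A \<in> L \<and> A \<in> C) \<and>
     (\<forall>A\<in>L. \<exists>C\<in>\<C>. A \<in> C) \<and>
     (\<forall>C\<in>\<C>. \<forall>A\<in>L \<inter> C. \<forall>B\<in>C. lex_le A B)"

end

theory Submission
  imports Defs
begin

text \<open>
  The moves generate an action of the group \<open>\<int> \<times> \<int>\<close> on square matrices, with \<open>(k, l)\<close> shifting rows
  cyclically by \<open>k\<close> and columns by \<open>l\<close>; since the action factors through \<open>\<int>/n \<times> \<int>/n\<close>, every shift is
  a composite of moves, and the equivalence classes are exactly the orbits
  (\<open>cyc_equiv_iff_shift\<close>). Multiplication by powers of the cyclic permutation matrix from both sides
  realises the same shifts (\<open>perm_conj_eq_shift\<close>), so the inequality tested in the third step says that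
  \<open>A\<close> is lexicographically least in its orbit (\<open>step3_iff\<close>). The bounds on the row codes and the
  requirement that the first code be smallest lose nothing: a row is constant precisely if its code is
  \<open>0\<close> or \<open>2^n - 1\<close>, and a matrix with a smaller code below the first row becomes lexicographically smaller
  when that row is shifted to the top.

  A matrix with entries 0 and 1 is determined by its tuple of codes, so the lexicographic order is
  linear on such matrices and each (finite, nonempty) orbit has exactly one least element. This settles the
  first list. The same argument applies to any shift-invariant subset of the matrices in question
  (\<open>lists_minimal_representatives_invariant\<close>). Reflection and rotation normalise the action -- they turn
  a shift into another shift -- so being equivalent to one's own reflection or rotation is shift-invariant, and the
  other two lists follow.
\<close>

section \<open>Cyclic shifts\<close>

text \<open>Integer shift amounts make the shifts a group action, so that inverses and the sign change
  under reflection need no truncated subtraction.\<close>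

definition cyc_shift :: "nat \<Rightarrow> int \<Rightarrow> int \<Rightarrow> nat mat \<Rightarrow> nat mat" where
  "cyc_shift n k l A = mat n n
     (\<lambda>(i, j). A $$ (nat ((int i + k) mod int n), nat ((int j + l) mod int n)))"

lemma nat_mod_less: "n \<ge> 1 \<Longrightarrow> nat (x mod int n) < n"
  by (simp add: nat_less_iff)

lemma cyc_shift_carrier [simp]: "cyc_shift n k l A \<in> carrier_mat n n"
  and cyc_shift_dim [simp]: "dim_row (cyc_shift n k l A) = n" "dim_col (cyc_shift n k l A) = n"
  by (simp_all add: cyc_shift_def)

lemma cyc_shift_index [simp]:
  "i < n \<Longrightarrow> j < n \<Longrightarrow>
    cyc_shift n k l A $$ (i, j) = A $$ (nat ((int i + k) mod int n), nat ((int j + l) mod int n))"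
  by (simp add: cyc_shift_def)

lemma cyc_shift_shift:
  assumes "n \<ge> 1"
  shows "cyc_shift n k l (cyc_shift n k' l' A) = cyc_shift n (k + k') (l + l') A"
  by (rule eq_matI)
    (use assms in \<open>simp_all add: nat_mod_less mod_add_right_eq ac_simps\<close>)

lemma cyc_shift_zero:
  assumes "A \<in> carrier_mat n n"
  shows "cyc_shift n 0 0 A = A"
  by (rule eq_matI) (use assms in auto)

lemma cyc_shift_cancel:
  assumes "n \<ge> 1" "A \<in> carrier_mat n n"
  shows "cyc_shift n (- k) (- l) (cyc_shift n k l A) = A"
  using assms by (simp add: cyc_shift_shift cyc_shift_zero)

lemma cyc_shift_mod: "cyc_shift n (k mod int n) (l mod int n) A = cyc_shift n k l A"
  by (rule eq_matI) (simp_all add: mod_add_right_eq)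

lemma col_reverse_shift:
  assumes "n \<ge> 1" "A \<in> carrier_mat n n"
  shows "col_reverse (cyc_shift n k l A) = cyc_shift n k (- l) (col_reverse A)"
proof (rule eq_matI)
  fix i j assume "i < dim_row (cyc_shift n k (- l) (col_reverse A))"
    "j < dim_col (cyc_shift n k (- l) (col_reverse A))"
  then have ij: "i < n" "j < n" by simp_all
  define u where "u = (int j - l) mod int n"
  have u: "0 \<le> u" "u < int n" using assms(1) by (simp_all add: u_def)
  \<comment> \<open>reflection negates column indices up to the constant n - 1, hence negates the column shift\<close>
  have "(int (n - 1 - j) + l) mod int n = (int n - 1 - (int j - l)) mod int n"
    using ij by (simp add: of_nat_diff algebra_simps)
  also have "\<dots> = (int n - 1 - u) mod int n"
    unfolding u_def by (simp add: mod_diff_right_eq)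
  also have "\<dots> = int n - 1 - u" using u by (intro mod_pos_pos_trivial) auto
  finally have "nat ((int (n - 1 - j) + l) mod int n) = n - 1 - nat u" using u by linarith
  then show "col_reverse (cyc_shift n k l A) $$ (i, j)
      = cyc_shift n k (- l) (col_reverse A) $$ (i, j)"
    using ij assms u nat_mod_less[OF assms(1)]
    by (simp add: col_reverse_def u_def)
qed (simp_all add: col_reverse_def)

lemma transpose_shift:
  assumes "n \<ge> 1" "A \<in> carrier_mat n n"
  shows "transpose_mat (cyc_shift n k l A) = cyc_shift n l k (transpose_mat A)"
  by (rule eq_matI) (use assms in \<open>auto simp: nat_mod_less\<close>)

lemma col_reverse_carrier: "A \<in> carrier_mat n n \<Longrightarrow> col_reverse A \<in> carrier_mat n n"
  by (simp add: col_reverse_def)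

lemma rotate_ccw_carrier: "A \<in> carrier_mat n n \<Longrightarrow> rotate_ccw A \<in> carrier_mat n n"
  by (simp add: rotate_ccw_def col_reverse_carrier)

lemma rotate_ccw_shift:
  assumes "n \<ge> 1" "A \<in> carrier_mat n n"
  shows "rotate_ccw (cyc_shift n k l A) = cyc_shift n (- l) k (rotate_ccw A)"
  using assms by (simp add: rotate_ccw_def col_reverse_shift transpose_shift col_reverse_carrier)

section \<open>Equivalence classes as orbits\<close>

lemma first_row_last_shift:
  assumes "A \<in> carrier_mat n n"
  shows "first_row_last A = cyc_shift n 1 0 A"
  by (rule eq_matI)
    (use assms in \<open>auto simp: first_row_last_def nat_mod_distrib nat_add_distrib\<close>)

lemma first_col_last_shift:
  assumes "A \<in> carrier_mat n n"
  shows "first_col_last A = cyc_shift n 0 1 A"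
  by (rule eq_matI)
    (use assms in \<open>auto simp: first_col_last_def nat_mod_distrib nat_add_distrib\<close>)

lemma moves_imp_shift:
  assumes "cyc_move\<^sup>*\<^sup>* A B" "A \<in> carrier_mat n n" "n \<ge> 1"
  shows "\<exists>k l. B = cyc_shift n k l A"
  using assms(1)
proof induction
  case base
  show ?case using cyc_shift_zero[OF assms(2)] by metis
next
  case (step B C)
  then obtain k l where B: "B = cyc_shift n k l A" by blast
  from step.hyps(2) have "C = cyc_shift n 1 0 B \<or> C = cyc_shift n 0 1 B"
    by (simp add: cyc_move_def B first_row_last_shift[of _ n] first_col_last_shift[of _ n])
  then show ?case unfolding B cyc_shift_shift[OF assms(3)] by blast
qed

lemma shift_imp_moves:
  assumes "A \<in> carrier_mat n n" "n \<ge> 1"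
  shows "cyc_move\<^sup>*\<^sup>* A (cyc_shift n k l A)"
proof -
  have rows: "cyc_move\<^sup>*\<^sup>* B (cyc_shift n (int a) 0 B)" if "B \<in> carrier_mat n n" for a B
  proof (induction a)
    case 0 then show ?case using that by (simp add: cyc_shift_zero)
  next
    case (Suc a)
    have "cyc_shift n (int (Suc a)) 0 B = first_row_last (cyc_shift n (int a) 0 B)"
      by (simp add: first_row_last_shift[of _ n] cyc_shift_shift[OF assms(2)])
    then have "cyc_move (cyc_shift n (int a) 0 B) (cyc_shift n (int (Suc a)) 0 B)"
      by (simp add: cyc_move_def)
    with Suc show ?case by (rule rtranclp.rtrancl_into_rtrancl)
  qed
  have cols: "cyc_move\<^sup>*\<^sup>* B (cyc_shift n 0 (int a) B)" if "B \<in> carrier_mat n n" for a B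
  proof (induction a)
    case 0 then show ?case using that by (simp add: cyc_shift_zero)
  next
    case (Suc a)
    have "cyc_shift n 0 (int (Suc a)) B = first_col_last (cyc_shift n 0 (int a) B)"
      by (simp add: first_col_last_shift[of _ n] cyc_shift_shift[OF assms(2)])
    then have "cyc_move (cyc_shift n 0 (int a) B) (cyc_shift n 0 (int (Suc a)) B)"
      by (simp add: cyc_move_def)
    with Suc show ?case by (rule rtranclp.rtrancl_into_rtrancl)
  qed
  \<comment> \<open>negative shifts agree with nonnegative ones modulo n\<close>
  define a b where "a = nat (k mod int n)" and "b = nat (l mod int n)"
  have "cyc_shift n k l A = cyc_shift n (k mod int n) (l mod int n) A"
    by (simp only: cyc_shift_mod)
  also have "\<dots> = cyc_shift n 0 (int b) (cyc_shift n (int a) 0 A)"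
    using assms(2) by (simp add: cyc_shift_shift a_def b_def)
  finally show ?thesis
    using rtranclp_trans[OF rows[OF assms(1)] cols[OF cyc_shift_carrier]] by simp
qed

lemma cyc_equiv_iff_shift:
  assumes "A \<in> carrier_mat n n" "B \<in> carrier_mat n n" "n \<ge> 1"
  shows "cyc_equiv A B \<longleftrightarrow> (\<exists>k l. B = cyc_shift n k l A)"
proof
  assume "cyc_equiv A B"
  then consider "cyc_move\<^sup>*\<^sup>* A B" | "cyc_move\<^sup>*\<^sup>* B A" by (auto simp: cyc_equiv_def)
  then show "\<exists>k l. B = cyc_shift n k l A"
  proof cases
    case 1 then show ?thesis using moves_imp_shift assms by blast
  next
    case 2
    then obtain k l where "A = cyc_shift n k l B" using moves_imp_shift assms by blast
    then show ?thesis using cyc_shift_cancel[OF assms(3,2)] by metis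
  qed
next
  assume "\<exists>k l. B = cyc_shift n k l A"
  then show "cyc_equiv A B" using shift_imp_moves assms by (auto simp: cyc_equiv_def)
qed

lemma binary_shift:
  "A \<in> binary_mats n \<Longrightarrow> n \<ge> 1 \<Longrightarrow> cyc_shift n k l A \<in> binary_mats n"
  by (auto simp: binary_mats_def nat_mod_less)

lemma Q_shift:
  assumes "A \<in> Q_mats n" "n \<ge> 1"
  shows "cyc_shift n k l A \<in> Q_mats n"
proof -
  have A: "A \<in> binary_mats n" using assms by (simp add: Q_mats_def)
  have row: "\<exists>j<n. cyc_shift n k l A $$ (i, j) = c"
    if less: "i < n" and nonempty: "\<And>i. i < n \<Longrightarrow> \<exists>j<n. A $$ (i, j) = c" for i c
  proof -
    obtain j where "j < n" "A $$ (nat ((int i + k) mod int n), j) = c"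
      using nonempty[OF nat_mod_less[OF assms(2)]] by blast
    then show ?thesis using less assms(2)
      by (intro exI[of _ "nat ((int j - l) mod int n)"])
        (simp add: nat_mod_less mod_add_left_eq)
  qed
  have col: "\<exists>i<n. cyc_shift n k l A $$ (i, j) = c"
    if less: "j < n" and nonempty: "\<And>j. j < n \<Longrightarrow> \<exists>i<n. A $$ (i, j) = c" for j c
  proof -
    obtain i where "i < n" "A $$ (i, nat ((int j + l) mod int n)) = c"
      using nonempty[OF nat_mod_less[OF assms(2)]] by blast
    then show ?thesis using less assms(2)
      by (intro exI[of _ "nat ((int i - k) mod int n)"])
        (simp add: nat_mod_less mod_add_left_eq)
  qed
  show ?thesis
    unfolding Q_mats_def mem_Collect_eq
    by (intro conjI allI impI binary_shift[OF A assms(2)] row col)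
      (use assms(1) in \<open>simp_all add: Q_mats_def\<close>)
qed

lemma cyc_rel_class:
  assumes "A \<in> binary_mats n" "n \<ge> 1"
  shows "cyc_rel n `` {A} = {cyc_shift n k l A |k l. True}"
proof -
  have "cyc_equiv A B \<longleftrightarrow> (\<exists>k l. B = cyc_shift n k l A)" if "B \<in> binary_mats n" for B
    using assms that by (intro cyc_equiv_iff_shift) (simp_all add: binary_mats_def)
  then show ?thesis
    using assms(1) binary_shift[OF assms] by (auto simp: cyc_rel_def)
qed

section \<open>Multiplication by powers of the cyclic permutation matrix\<close>

lemma cyc_perm_mat_carrier: "cyc_perm_mat n \<in> carrier_mat n n"
  by (simp add: cyc_perm_mat_def)

lemma cyc_perm_mat_pow:
  assumes "n \<ge> 1"
  shows "cyc_perm_mat n ^\<^sub>m k = mat n n (\<lambda>(i, j). if j = (i + k) mod n then 1 else 0)"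
proof (induction k)
  case 0
  show ?case by (rule eq_matI) (auto simp: cyc_perm_mat_def)
next
  case (Suc k)
  show ?case
  proof (rule eq_matI)
    fix i j assume "i < dim_row (mat n n (\<lambda>(i, j). if j = (i + Suc k) mod n then 1 else (0::nat)))"
      "j < dim_col (mat n n (\<lambda>(i, j). if j = (i + Suc k) mod n then 1 else (0::nat)))"
    then have ij: "i < n" "j < n" by simp_all
    define m where "m = (i + k) mod n"
    have m: "m < n" using assms by (simp add: m_def)
    have "(cyc_perm_mat n ^\<^sub>m Suc k) $$ (i, j)
        = (\<Sum>x = 0..<n. (if x = m then 1 else 0) * cyc_perm_mat n $$ (x, j))"
      using ij cyc_perm_mat_carrier[of n] by (simp add: Suc scalar_prod_def m_def)
    also have "\<dots> = (\<Sum>x = 0..<n. if x = m then cyc_perm_mat n $$ (m, j) else 0)"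
      by (intro sum.cong) auto
    also have "\<dots> = cyc_perm_mat n $$ (m, j)" using m by (simp add: sum.delta)
    also have "\<dots> = (if j = Suc m mod n then 1 else 0)"
      using m ij by (auto simp: cyc_perm_mat_def mod_Suc)
    also have "Suc m mod n = (i + Suc k) mod n" by (simp add: m_def mod_Suc_eq)
    finally show "(cyc_perm_mat n ^\<^sub>m Suc k) $$ (i, j)
        = mat n n (\<lambda>(i, j). if j = (i + Suc k) mod n then 1 else 0) $$ (i, j)"
      using ij by simp
  qed (simp_all add: cyc_perm_mat_def Suc)
qed

text \<open>The sign of \<open>l\<close> differs from that of \<open>k\<close> because \<open>P\<close> sends row \<open>i + 1\<close> to row \<open>i\<close> when it acts
  from the left, but column \<open>j\<close> to column \<open>j + 1\<close> when it acts from the right.\<close>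

lemma perm_conj_eq_shift:
  assumes "n \<ge> 1" "A \<in> binary_mats n"
  shows "cyc_perm_mat n ^\<^sub>m k *\<^sub>L A *\<^sub>L cyc_perm_mat n ^\<^sub>m l = cyc_shift n (int k) (- int l) A"
    (is "?L *\<^sub>L A *\<^sub>L ?R = _")
proof (rule eq_matI)
  have A: "A \<in> carrier_mat n n" using assms by (simp add: binary_mats_def)
  fix i j assume "i < dim_row (cyc_shift n (int k) (- int l) A)"
    "j < dim_col (cyc_shift n (int k) (- int l) A)"
  then have ij: "i < n" "j < n" by simp_all
  define i' j' where "i' = (i + k) mod n" and "j' = nat ((int j - int l) mod int n)"
  have i': "i' < n" and j': "j' < n" using assms(1) by (simp_all add: i'_def j'_def nat_mod_less)
  have col: "j = (x + l) mod n \<longleftrightarrow> x = j'" if "x < n" for x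
  proof -
    have "j = (x + l) mod n \<longleftrightarrow> int j = (int x + int l) mod int n"
      by (simp flip: of_nat_mod of_nat_add)
    also have "\<dots> \<longleftrightarrow> int j mod int n = (int x + int l) mod int n" using ij by simp
    also have "\<dots> \<longleftrightarrow> (int j - int l) mod int n = int x mod int n"
      by (simp add: mod_eq_dvd_iff algebra_simps)
    also have "\<dots> \<longleftrightarrow> x = j'" using that assms(1) by (auto simp: j'_def)
    finally show ?thesis .
  qed
  have L: "(?L *\<^sub>L A) $$ (i, x) = (if A $$ (i', x) = 1 then 1 else 0)" if "x < n" for x
  proof -
    have "?L $$ (i, y) = 1 \<longleftrightarrow> y = i'" if "y < n" for y
      using ij that by (simp add: cyc_perm_mat_pow[OF assms(1)] i'_def)
    moreover have "dim_col ?L = n" "dim_row ?L = n"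
      by (simp_all add: cyc_perm_mat_pow[OF assms(1)])
    ultimately show ?thesis
      unfolding logical_prod_def using ij that A i' by auto
  qed
  have dim: "dim_row (?L *\<^sub>L A) = n" "dim_col (?L *\<^sub>L A) = n"
    using A by (simp_all add: logical_prod_def cyc_perm_mat_pow[OF assms(1)])
  have "(?L *\<^sub>L A *\<^sub>L ?R) $$ (i, j)
      = (if \<exists>x<n. (?L *\<^sub>L A) $$ (i, x) = 1 \<and> ?R $$ (x, j) = 1 then 1 else 0)"
    using ij unfolding logical_prod_def[of "?L *\<^sub>L A"] dim
    by (simp add: cyc_perm_mat_pow[OF assms(1)])
  also have "(\<exists>x<n. (?L *\<^sub>L A) $$ (i, x) = 1 \<and> ?R $$ (x, j) = 1) \<longleftrightarrow> A $$ (i', j') = 1"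
  proof -
    have "(?L *\<^sub>L A) $$ (i, x) = 1 \<longleftrightarrow> A $$ (i', x) = 1" if "x < n" for x
      using that by (simp add: L)
    moreover have "?R $$ (x, j) = 1 \<longleftrightarrow> x = j'" if "x < n" for x
      using that ij by (simp add: cyc_perm_mat_pow[OF assms(1)] flip: col)
    ultimately show ?thesis using j' by blast
  qed
  also have "(if A $$ (i', j') = 1 then 1 else 0) = A $$ (i', j')"
    using assms(2) i' j' by (auto simp: binary_mats_def)
  finally show "(?L *\<^sub>L A *\<^sub>L ?R) $$ (i, j) = cyc_shift n (int k) (- int l) A $$ (i, j)"
    using ij by (simp add: i'_def j'_def flip: of_nat_add of_nat_mod)
qed (use assms in \<open>simp_all add: logical_prod_def cyc_perm_mat_pow binary_mats_def\<close>)

lemma all_perm_conj_iff_all_shift: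
  assumes "n \<ge> 1" "A \<in> binary_mats n"
  shows "(\<forall>k<n. \<forall>l<n. R (cyc_perm_mat n ^\<^sub>m k *\<^sub>L A *\<^sub>L cyc_perm_mat n ^\<^sub>m l))
    \<longleftrightarrow> (\<forall>k l. R (cyc_shift n k l A))"
proof
  assume *: "\<forall>k<n. \<forall>l<n. R (cyc_perm_mat n ^\<^sub>m k *\<^sub>L A *\<^sub>L cyc_perm_mat n ^\<^sub>m l)"
  show "\<forall>k l. R (cyc_shift n k l A)"
  proof (intro allI)
    fix k l :: int
    define a b where "a = nat (k mod int n)" and "b = nat (- l mod int n)"
    have "cyc_shift n (int a) (- int b) A
        = cyc_shift n (int a mod int n) (- int b mod int n) A"
      by (simp only: cyc_shift_mod)
    also have "\<dots> = cyc_shift n (k mod int n) (l mod int n) A"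
      using assms(1) by (simp add: a_def b_def mod_minus_eq)
    also have "\<dots> = cyc_shift n k l A" by (rule cyc_shift_mod)
    finally have "cyc_shift n k l A = cyc_shift n (int a) (- int b) A" ..
    moreover have "a < n" "b < n" using assms(1) by (simp_all add: a_def b_def nat_mod_less)
    ultimately show "R (cyc_shift n k l A)" using * perm_conj_eq_shift[OF assms] by metis
  qed
qed (simp add: perm_conj_eq_shift[OF assms])

section \<open>Row codes\<close>

definition bin_code :: "nat \<Rightarrow> (nat \<Rightarrow> nat) \<Rightarrow> nat" where
  "bin_code n a = (\<Sum>j<n. a j * 2 ^ (n - 1 - j))"

text \<open>The entry with the largest column index is the least significant digit, so codes obey Horner's
  recursion, which drives every induction on codes.\<close>

lemma bin_code_Suc: "bin_code (Suc n) a = 2 * bin_code n a + a n"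
proof -
  have "(\<Sum>j<n. a j * 2 ^ (n - j)) = (\<Sum>j<n. 2 * (a j * 2 ^ (n - 1 - j)))"
  proof (rule sum.cong)
    fix j assume "j \<in> {..<n}"
    then have "n - j = Suc (n - 1 - j)" by auto
    then show "a j * 2 ^ (n - j) = 2 * (a j * 2 ^ (n - 1 - j))" by simp
  qed simp
  then show ?thesis by (simp add: bin_code_def sum_distrib_left)
qed

lemma bin_code_zeros: "\<forall>j<n. a j = 0 \<Longrightarrow> bin_code n a = 0"
  by (simp add: bin_code_def)

lemma bin_code_ones: "\<forall>j<n. a j = 1 \<Longrightarrow> bin_code n a = 2 ^ n - 1"
proof (induction n)
  case (Suc n)
  moreover have "(2::nat) ^ n \<ge> 1" by simp
  ultimately have "2 * (2 ^ n - 1) + 1 = (2::nat) ^ Suc n - 1"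
    unfolding power_Suc by linarith
  moreover have "bin_code n a = 2 ^ n - 1" "a n = 1" using Suc by simp_all
  ultimately show ?case by (simp only: bin_code_Suc)
qed (simp add: bin_code_def)

lemma bin_code_inj:
  assumes "bin_code n a = bin_code n b" "\<forall>j<n. a j \<in> {0, 1}" "\<forall>j<n. b j \<in> {0, 1}"
  shows "\<forall>j<n. a j = b j"
  using assms
proof (induction n)
  case (Suc n)
  have "a n \<in> {0, 1}" "b n \<in> {0, 1}" using Suc.prems by auto
  then have "a n = b n" "bin_code n a = bin_code n b"
    using Suc.prems(1) unfolding bin_code_Suc by (auto, presburger+)
  moreover have "\<forall>j<n. a j \<in> {0, 1}" "\<forall>j<n. b j \<in> {0, 1}" using Suc.prems by simp_all
  ultimately show ?case using Suc.IH by (metis less_Suc_eq)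
qed simp

lemma bin_code_less: "\<forall>j<n. a j \<in> {0, 1} \<Longrightarrow> bin_code n a < 2 ^ n"
proof (induction n)
  case (Suc n)
  then have "a n \<in> {0, 1}" "bin_code n a < 2 ^ n" by auto
  then show ?case by (auto simp: bin_code_Suc)
qed (simp add: bin_code_def)

lemma bin_code_nonconstant_iff:
  assumes "\<forall>j<n. a j \<in> {0, 1}"
  shows "1 \<le> bin_code n a \<and> bin_code n a \<le> 2 ^ n - 2 \<longleftrightarrow> (\<exists>j<n. a j = 0) \<and> (\<exists>j<n. a j = 1)"
proof -
  have zero: "bin_code n a = 0 \<longleftrightarrow> (\<forall>j<n. a j = 0)"
    using bin_code_zeros[of n a] bin_code_zeros[of n "\<lambda>_. 0"] bin_code_inj[of n a "\<lambda>_. 0"] assms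
    by auto
  have one: "bin_code n a = 2 ^ n - 1 \<longleftrightarrow> (\<forall>j<n. a j = 1)"
    using bin_code_ones[of n a] bin_code_ones[of n "\<lambda>_. 1"] bin_code_inj[of n a "\<lambda>_. 1"] assms
    by auto
  have "1 \<le> bin_code n a \<and> bin_code n a \<le> 2 ^ n - 2
      \<longleftrightarrow> bin_code n a \<noteq> 0 \<and> bin_code n a \<noteq> 2 ^ n - 1"
    using bin_code_less[OF assms] by linarith
  then show ?thesis using zero one assms by auto
qed

lemma row_tuple_eq:
  assumes "A \<in> carrier_mat n n"
  shows "row_tuple A = map (\<lambda>i. bin_code n (\<lambda>j. A $$ (i, j))) [0..<n]"
  using assms by (simp add: row_tuple_def bin_code_def)

lemma row_tuple_inj:
  assumes "A \<in> binary_mats n" "B \<in> binary_mats n" "row_tuple A = row_tuple B"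
  shows "A = B"
proof -
  have AB: "A \<in> carrier_mat n n" "B \<in> carrier_mat n n" using assms by (simp_all add: binary_mats_def)
  have "A $$ (i, j) = B $$ (i, j)" if "i < n" "j < n" for i j
  proof -
    have "bin_code n (\<lambda>j. A $$ (i, j)) = bin_code n (\<lambda>j. B $$ (i, j))"
      using assms(3) that by (simp add: row_tuple_eq[OF AB(1)] row_tuple_eq[OF AB(2)])
    then have "\<forall>j<n. A $$ (i, j) = B $$ (i, j)"
      by (rule bin_code_inj) (use that assms(1,2) in \<open>simp_all add: binary_mats_def\<close>)
    then show ?thesis using that by blast
  qed
  then show ?thesis using AB by (intro eq_matI) auto
qed

lemma lex_le_antisym:
  "A \<in> binary_mats n \<Longrightarrow> B \<in> binary_mats n \<Longrightarrow> lex_le A B \<Longrightarrow> lex_le B A \<Longrightarrow> A = B"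
  unfolding lex_le_def using row_tuple_inj by force

lemma le_list_imp_nth_0_le:
  fixes xs ys :: "nat list"
  assumes "xs \<le> ys" "xs \<noteq> []" "ys \<noteq> []"
  shows "xs ! 0 \<le> ys ! 0"
  using assms by (cases xs; cases ys) auto

lemma rows_nonconstant_iff:
  assumes "A \<in> binary_mats n"
  shows "(\<forall>i<n. 1 \<le> row_tuple A ! i \<and> row_tuple A ! i \<le> 2 ^ n - 2)
    \<longleftrightarrow> (\<forall>i<n. (\<exists>j<n. A $$ (i, j) = 0) \<and> (\<exists>j<n. A $$ (i, j) = 1))"
proof -
  have A: "A \<in> carrier_mat n n" using assms by (simp add: binary_mats_def)
  have "1 \<le> row_tuple A ! i \<and> row_tuple A ! i \<le> 2 ^ n - 2
      \<longleftrightarrow> (\<exists>j<n. A $$ (i, j) = 0) \<and> (\<exists>j<n. A $$ (i, j) = 1)" if "i < n" for i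
    using bin_code_nonconstant_iff[of n "\<lambda>j. A $$ (i, j)"] assms that
    by (simp add: row_tuple_eq[OF A] binary_mats_def)
  then show ?thesis by blast
qed

lemma Q_iff_no_constant_col:
  assumes "A \<in> binary_mats n" "row_tuple A \<in> step1 n"
  shows "A \<in> Q_mats n \<longleftrightarrow> no_constant_col A"
proof -
  have A: "dim_row A = n" "dim_col A = n" and bin: "\<forall>i<n. \<forall>j<n. A $$ (i, j) \<in> {0, 1}"
    using assms(1) by (auto simp: binary_mats_def)
  have rows: "\<forall>i<n. (\<exists>j<n. A $$ (i, j) = 0) \<and> (\<exists>j<n. A $$ (i, j) = 1)"
    using rows_nonconstant_iff[OF assms(1)] assms(2) by (simp add: step1_def)
  have "no_constant_col A \<longleftrightarrow> (\<forall>j<n. (\<exists>i<n. A $$ (i, j) = 0) \<and> (\<exists>i<n. A $$ (i, j) = 1))"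
    unfolding no_constant_col_def A using bin by (metis insertE singletonD zero_neq_one)
  then show ?thesis using assms(1) rows unfolding Q_mats_def by blast
qed

section \<open>Least elements of orbits\<close>

text \<open>Membership of the tuple in the list of the first step follows from minimality: a row with a
  smaller code could be shifted to the top, where it would decide the comparison.\<close>

lemma step3_iff:
  assumes "n \<ge> 1"
  shows "A \<in> step3 n \<longleftrightarrow> A \<in> Q_mats n \<and> (\<forall>k l. lex_le A (cyc_shift n k l A))"
proof
  assume "A \<in> step3 n"
  then show "A \<in> Q_mats n \<and> (\<forall>k l. lex_le A (cyc_shift n k l A))"
    using all_perm_conj_iff_all_shift[OF assms, of A "lex_le A"] by (auto simp: step3_def step2_def)
next
  assume *: "A \<in> Q_mats n \<and> (\<forall>k l. lex_le A (cyc_shift n k l A))"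
  then have bin: "A \<in> binary_mats n" by (simp add: Q_mats_def)
  then have A: "A \<in> carrier_mat n n" by (simp add: binary_mats_def)
  have "row_tuple A ! 0 \<le> row_tuple A ! i" if "i < n" for i
  proof -
    let ?B = "cyc_shift n (int i) 0 A"
    have "row_tuple A \<le> row_tuple ?B" using * by (simp add: lex_le_def)
    then have "row_tuple A ! 0 \<le> row_tuple ?B ! 0"
      using assms by (intro le_list_imp_nth_0_le)
        (simp_all add: row_tuple_eq[OF A] row_tuple_eq[OF cyc_shift_carrier])
    also have "row_tuple ?B ! 0 = row_tuple A ! i"
      using assms that
      by (simp add: row_tuple_eq[OF A] row_tuple_eq[OF cyc_shift_carrier] bin_code_def)
    finally show ?thesis .
  qed
  moreover have "\<forall>i<n. 1 \<le> row_tuple A ! i \<and> row_tuple A ! i \<le> 2 ^ n - 2"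
    using * unfolding rows_nonconstant_iff[OF bin] by (simp add: Q_mats_def)
  moreover have "length (row_tuple A) = n" by (simp add: row_tuple_eq[OF A])
  ultimately have "row_tuple A \<in> step1 n" by (simp add: step1_def)
  then show "A \<in> step3 n"
    using * bin all_perm_conj_iff_all_shift[OF assms bin, of "lex_le A"]
    by (simp add: step3_def step2_def)
qed

lemma ex_least_shift:
  assumes "n \<ge> 1"
  shows "\<exists>k l. \<forall>k' l'. lex_le (cyc_shift n k l A) (cyc_shift n k' l' A)"
proof -
  let ?O = "(\<lambda>(k, l). row_tuple (cyc_shift n k l A)) ` ({0..<int n} \<times> {0..<int n})"
  have fin: "finite ?O" by simp
  have mem: "row_tuple (cyc_shift n k l A) \<in> ?O" for k l
  proof -
    have "row_tuple (cyc_shift n k l A)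
        = (\<lambda>(k, l). row_tuple (cyc_shift n k l A)) (k mod int n, l mod int n)"
      by (simp add: cyc_shift_mod)
    then show ?thesis by (rule image_eqI) (use assms in simp)
  qed
  have "Min ?O \<in> ?O" using fin mem by (intro Min_in) blast+
  then obtain k l where "row_tuple (cyc_shift n k l A) = Min ?O" by auto
  then show ?thesis using Min_le[OF fin mem] unfolding lex_le_def by metis
qed

text \<open>Shift-invariance of \<open>P\<close> makes a class that meets \<open>P\<close> lie inside it, so that the least element
  of the class is again selected.\<close>

lemma lists_minimal_representatives_invariant:
  assumes n: "n \<ge> 1"
    and inv: "\<And>A k l. A \<in> Q_mats n \<Longrightarrow> P A \<Longrightarrow> P (cyc_shift n k l A)"
  shows "lists_minimal_representatives {A \<in> step3 n. P A} ({A \<in> Q_mats n. P A} // cyc_rel n)"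
proof -
  let ?L = "{A \<in> step3 n. P A}" and ?C = "{A \<in> Q_mats n. P A} // cyc_rel n"
  have Q_bin: "A \<in> binary_mats n" if "A \<in> Q_mats n" for A using that by (simp add: Q_mats_def)
  have Q_carrier: "A \<in> carrier_mat n n" if "A \<in> Q_mats n" for A
    using that by (simp add: Q_mats_def binary_mats_def)
  have classes: "C \<in> ?C \<longleftrightarrow> (\<exists>A \<in> Q_mats n. P A \<and> C = {cyc_shift n k l A |k l. True})" for C
    unfolding quotient_def using cyc_rel_class[OF Q_bin n] by auto
  have least: "lex_le A B" if C: "C \<in> ?C" and "A \<in> ?L" "A \<in> C" "B \<in> C" for A B C
  proof -
    obtain D where D: "D \<in> Q_mats n" "C = {cyc_shift n k l D |k l. True}"
      using C unfolding classes by blast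
    then obtain a b c d where A: "A = cyc_shift n a b D" and B: "B = cyc_shift n c d D"
      using \<open>A \<in> C\<close> \<open>B \<in> C\<close> by auto
    have "B = cyc_shift n (c - a) (d - b) A"
      by (simp add: A B cyc_shift_shift[OF n])
    then show ?thesis using \<open>A \<in> ?L\<close> by (simp add: step3_iff[OF n])
  qed
  have "\<exists>!A. A \<in> ?L \<and> A \<in> C" if C: "C \<in> ?C" for C
  proof (rule ex_ex1I)
    obtain D where D: "D \<in> Q_mats n" "P D" "C = {cyc_shift n k l D |k l. True}"
      using C unfolding classes by blast
    obtain k l where kl: "\<And>k' l'. lex_le (cyc_shift n k l D) (cyc_shift n k' l' D)"
      using ex_least_shift[OF n] by blast
    then have "cyc_shift n k l D \<in> step3 n"
      using Q_shift[OF D(1) n] by (simp add: step3_iff[OF n] cyc_shift_shift[OF n])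
    then show "\<exists>A. A \<in> ?L \<and> A \<in> C" using inv[OF D(1,2)] D(3) by blast
  next
    fix A B assume AB: "A \<in> ?L \<and> A \<in> C" "B \<in> ?L \<and> B \<in> C"
    then have "A \<in> binary_mats n" "B \<in> binary_mats n" using Q_bin by (auto simp: step3_iff[OF n])
    then show "A = B" using lex_le_antisym least[OF C] AB by blast
  qed
  moreover have "\<exists>C\<in>?C. A \<in> C" if "A \<in> ?L" for A
  proof -
    have A: "A \<in> Q_mats n" "P A" using that by (auto simp: step3_iff[OF n])
    then have "A = cyc_shift n 0 0 A" using cyc_shift_zero[OF Q_carrier] by simp
    then have "A \<in> {cyc_shift n k l A |k l. True}" by blast
    moreover have "{cyc_shift n k l A |k l. True} \<in> ?C"
      unfolding classes using A by (intro bexI[of _ A]) simp_all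
    ultimately show ?thesis by (rule rev_bexI[rotated])
  qed
  ultimately show ?thesis
    unfolding lists_minimal_representatives_def
    by (intro conjI ballI) (assumption | erule IntE | rule least)+
qed

text \<open>If \<open>f A\<close> is a shift of \<open>A\<close> and \<open>f\<close> turns the shift \<open>s A\<close> into some shift of \<open>f A\<close>, then \<open>f (s A)\<close>
  lies in the orbit of \<open>A\<close>, which is also that of \<open>s A\<close>. Reflection and rotation are the instances.\<close>

lemma cyc_equiv_image_shift_invariant:
  assumes n: "n \<ge> 1" and A: "A \<in> carrier_mat n n"
    and carrier: "\<And>B. B \<in> carrier_mat n n \<Longrightarrow> f B \<in> carrier_mat n n"
    and normal: "\<And>k l. \<exists>k' l'. f (cyc_shift n k l A) = cyc_shift n k' l' (f A)"
    and equiv: "cyc_equiv A (f A)"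
  shows "cyc_equiv (cyc_shift n k l A) (f (cyc_shift n k l A))"
proof -
  obtain a b where fA: "f A = cyc_shift n a b A"
    using equiv unfolding cyc_equiv_iff_shift[OF A carrier[OF A] n] by (elim exE)
  obtain k' l' where "f (cyc_shift n k l A) = cyc_shift n k' l' (f A)"
    using normal[of k l] by (elim exE)
  then have "f (cyc_shift n k l A)
      = cyc_shift n (k' + a - k) (l' + b - l) (cyc_shift n k l A)"
    by (simp add: fA cyc_shift_shift[OF n])
  then show ?thesis
    unfolding cyc_equiv_iff_shift[OF cyc_shift_carrier carrier[OF cyc_shift_carrier] n]
    by (intro exI)
qed

theorem mainTheorem2:
  fixes n :: nat
  assumes "n \<ge> 1"
  shows "(\<forall>A\<in>binary_mats n. row_tuple A \<in> step1 n \<longrightarrow> (A \<in> Q_mats n \<longleftrightarrow> no_constant_col A)) \<and>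
    lists_minimal_representatives (step3 n) (Q_classes n) \<and>
    lists_minimal_representatives (step4 n) (M_classes n) \<and>
    lists_minimal_representatives (step5 n) (R_classes n)"
proof (intro conjI)
  have Q: "A \<in> carrier_mat n n" if "A \<in> Q_mats n" for A
    using that by (simp add: Q_mats_def binary_mats_def)
  show "\<forall>A\<in>binary_mats n. row_tuple A \<in> step1 n \<longrightarrow> (A \<in> Q_mats n \<longleftrightarrow> no_constant_col A)"
    using Q_iff_no_constant_col by blast
  show "lists_minimal_representatives (step3 n) (Q_classes n)"
    using lists_minimal_representatives_invariant[OF assms, of "\<lambda>_. True"]
    by (simp add: Q_classes_def)
  show "lists_minimal_representatives (step4 n) (M_classes n)"
    unfolding step4_def M_classes_def
  proof (rule lists_minimal_representatives_invariant[OF assms])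
    fix A k l assume A: "A \<in> Q_mats n" and *: "cyc_equiv A (col_reverse A)"
    show "cyc_equiv (cyc_shift n k l A) (col_reverse (cyc_shift n k l A))"
    proof (rule cyc_equiv_image_shift_invariant[where f = col_reverse, OF assms Q[OF A] col_reverse_carrier _ *])
      show "\<exists>k' l'. col_reverse (cyc_shift n k l A) = cyc_shift n k' l' (col_reverse A)" for k l
        using col_reverse_shift[OF assms Q[OF A]] by blast
    qed
  qed
  show "lists_minimal_representatives (step5 n) (R_classes n)"
    unfolding step5_def R_classes_def
  proof (rule lists_minimal_representatives_invariant[OF assms])
    fix A k l assume A: "A \<in> Q_mats n" and *: "cyc_equiv A (rotate_ccw A)"
    show "cyc_equiv (cyc_shift n k l A) (rotate_ccw (cyc_shift n k l A))"
    proof (rule cyc_equiv_image_shift_invariant[where f = rotate_ccw, OF assms Q[OF A] rotate_ccw_carrier _ *])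
      show "\<exists>k' l'. rotate_ccw (cyc_shift n k l A) = cyc_shift n k' l' (rotate_ccw A)" for k l
        using rotate_ccw_shift[OF assms Q[OF A]] by blast
    qed
  qed
qed

end
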